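(* Let $m,g,t\ge 1$ be integers. Under the identification of a ruler $(x_0,\dots,x_m)$ with its vector of successive differences $\mathbf{z}=(z_1,\dots,z_m)$, $z_i=x_i-x_{i-1}$, the $B_2^-[g]$-sets with $m+1$ markings and length $t$ are in bijection with the lattice points (points of $\mathbb{Z}^m$) in the interior of $t\Delta_{m-1}$ that are not contained in any subspace of the form $$\sum_{i\in U_0}z_i=\sum_{i\in U_1}z_i=\cdots=\sum_{i\in U_g}z_i,$$ where $U_0,\dots,U_g$ are consecutive subsets of $[m]$, none of which is contained in another.
   Context: A ruler of length $t$ with $m+1$ markings is a sequence of integers $0=x_0<x_1<\cdots<x_{m-1}<x_m=t$. It is a $B_2^-[g]$-set if each positive integer admits at most $g$ representations as a difference of two markings, a representation of $n$ being a pair of indices $i<j$ with $x_j-x_i=n$. $[m]=\{1,\dots,m\}$, and $\Delta_{m-1}=\{\mathbf{z}\in\mathbb{R}^m: z_1,\dots,z_m\ge 0,\ \sum_{i=1}^m z_i=1\}$. The interior of $t\Delta_{m-1}$ means its relative interior, $\{\mathbf{z}: z_i>0\text{ for all }i,\ \sum_i z_i=t\}$. A consecutive subset of $[m]$ is a nonempty set of the form $\{j,j+1,\dots,k\}$. "None of which is contained in another" means $U_a\not\subseteq U_b$ for all indices $a\neq b$ (so in particular the $U_a$ are pairwise distinct). *)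

theory Defs
  imports Complex_Main "HOL-Library.FuncSet"
begin

text \<open>
  Finite sequences and vectors are extensional functions on their index set: a ruler is a function
  on \<open>{0..m}\<close>, and \<open>\<real>\<^sup>m\<close> is the set \<open>real_space m\<close> of functions on \<open>[m] = {1..m}\<close>. Without
  extensionality, different functions could represent the same sequence, and a bijection between
  the two sides would not be the intended one.
\<close>

definition rulers :: "nat \<Rightarrow> nat \<Rightarrow> (nat \<Rightarrow> int) set" where
  "rulers m t = {x \<in> {0..m} \<rightarrow>\<^sub>E UNIV.
     x 0 = 0 \<and> x m = int t \<and> (\<forall>i<m. x i < x (Suc i))}"

definition representations :: "nat \<Rightarrow> (nat \<Rightarrow> int) \<Rightarrow> int \<Rightarrow> (nat \<times> nat) set" where
  "representations m x n = {(i, j). i < j \<and> j \<le> m \<and> x j - x i = n}"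

definition B2_minus_sets :: "nat \<Rightarrow> nat \<Rightarrow> nat \<Rightarrow> (nat \<Rightarrow> int) set" where
  "B2_minus_sets g m t =
     {x \<in> rulers m t. \<forall>n>0. card (representations m x n) \<le> g}"

definition real_space :: "nat \<Rightarrow> (nat \<Rightarrow> real) set" where
  "real_space m = {1..m} \<rightarrow>\<^sub>E UNIV"

definition successive_differences :: "nat \<Rightarrow> (nat \<Rightarrow> int) \<Rightarrow> nat \<Rightarrow> real" where
  "successive_differences m x = (\<lambda>i\<in>{1..m}. real_of_int (x i - x (i - 1)))"

definition lattice_points :: "nat \<Rightarrow> (nat \<Rightarrow> real) set" where
  "lattice_points m = {z \<in> real_space m. \<forall>i\<in>{1..m}. z i \<in> \<int>}"

text \<open>The relative interior of the dilate \<open>t\<Delta>\<^bsub>m-1\<^esub>\<close> of the standard simplex in \<open>\<real>\<^sup>m\<close>.\<close>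

definition dilated_simplex_interior :: "nat \<Rightarrow> nat \<Rightarrow> (nat \<Rightarrow> real) set" where
  "dilated_simplex_interior m t =
     {z \<in> real_space m. (\<forall>i\<in>{1..m}. 0 < z i) \<and> (\<Sum>i=1..m. z i) = real t}"

definition consecutive_subset :: "nat \<Rightarrow> nat set \<Rightarrow> bool" where
  "consecutive_subset m U \<longleftrightarrow> (\<exists>j k. 1 \<le> j \<and> j \<le> k \<and> k \<le> m \<and> U = {j..k})"

definition equal_sums_subspace :: "nat \<Rightarrow> nat \<Rightarrow> (nat \<Rightarrow> nat set) \<Rightarrow> (nat \<Rightarrow> real) set" where
  "equal_sums_subspace m g U =
     {z \<in> real_space m. \<forall>a\<le>g. \<forall>b\<le>g. (\<Sum>i\<in>U a. z i) = (\<Sum>i\<in>U b. z i)}"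

definition forbidden_subspaces :: "nat \<Rightarrow> nat \<Rightarrow> (nat \<Rightarrow> real) set set" where
  "forbidden_subspaces m g =
     {equal_sums_subspace m g U | U.
        (\<forall>a\<le>g. consecutive_subset m (U a)) \<and>
        (\<forall>a\<le>g. \<forall>b\<le>g. a \<noteq> b \<longrightarrow> \<not> U a \<subseteq> U b)}"

end

theory Submission
  imports Defs
begin

text \<open>
  Consecutive sums of the difference vector \<open>z\<close> of a ruler \<open>x\<close> are the differences \<open>x j - x i\<close>, so
  a representation \<open>(i, j)\<close> of \<open>n\<close> is a consecutive set \<open>{i+1..j}\<close> with sum \<open>n\<close>. Distinct
  representations of the same \<open>n\<close> give sets not contained in one another, because all \<open>z i\<close> are
  positive; conversely, the sets defining a forbidden subspace through \<open>z\<close> are \<open>g + 1\<close> distinct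
  representations of their common (positive) sum.
\<close>

text \<open>Telescoping. The block starts at \<open>Suc i\<close> because \<open>z l\<close> is the
  gap between markings \<open>l - 1\<close> and \<open>l\<close>; the empty block
  \<open>i = j\<close> is allowed, so partial sums from marking 0 are covered.\<close>

lemma sum_successive_differences:
  assumes "i \<le> j" "j \<le> m"
  shows "(\<Sum>l\<in>{Suc i..j}. successive_differences m x l) = real_of_int (x j - x i)"
  using assms
proof (induction j rule: dec_induct)
  case (step k)
  then show ?case
    by (simp add: successive_differences_def)
qed simp

lemma ruler_less:
  assumes "x \<in> rulers m t" "i < j" "j \<le> m"
  shows "x i < x j"
  using assms(2,3)
proof (induction j)
  case (Suc j)
  have "x j < x (Suc j)"
    using assms(1) Suc.prems by (simp add: rulers_def)
  with Suc show ?case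
    by (cases "i = j") auto
qed simp

lemma ruler_le:
  assumes "x \<in> rulers m t" "i \<le> j" "j \<le> m"
  shows "x i \<le> x j"
  using ruler_less[OF assms(1)] assms(2,3) by (cases "i = j") (auto simp: less_le)

text \<open>Guards against \<open>card\<close> being 0 on infinite sets when an injection is turned
  into a lower bound.\<close>

lemma finite_representations: "finite (representations m x n)"
  by (rule finite_subset[of _ "{..m} \<times> {..m}"]) (auto simp: representations_def)

lemma bij_betw_rulers_lattice_points:
  "bij_betw (successive_differences m) (rulers m t)
     (lattice_points m \<inter> dilated_simplex_interior m t)"
\<comment> \<open>The inverse takes partial sums of the gaps; the empty sum at \<open>k = 0\<close>
  supplies \<open>x 0 = 0\<close>. The floor only changes the type from \<open>real\<close> to
  \<open>int\<close>.\<close>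
proof (rule bij_betwI[where g = "\<lambda>z. \<lambda>k\<in>{0..m}. \<lfloor>\<Sum>l\<in>{Suc 0..k}. z l\<rfloor>"])
  show "successive_differences m \<in> rulers m t \<rightarrow> lattice_points m \<inter> dilated_simplex_interior m t"
  proof
    fix x assume x: "x \<in> rulers m t"
    have "successive_differences m x \<in> real_space m"
      by (auto simp: successive_differences_def real_space_def)
    moreover have "0 < successive_differences m x i" if "i \<in> {1..m}" for i
      using that ruler_less[OF x, of "i - 1" i] by (auto simp: successive_differences_def)
    moreover have "successive_differences m x i \<in> \<int>" if "i \<in> {1..m}" for i
      using that by (simp add: successive_differences_def)
    moreover have "(\<Sum>i=1..m. successive_differences m x i) = real t"
      using sum_successive_differences[of 0 m m x] x by (simp add: rulers_def)
    ultimately show "successive_differences m x \<in> lattice_points m \<inter> dilated_simplex_interior m t"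
      by (simp add: lattice_points_def dilated_simplex_interior_def)
  qed
next
  \<comment> \<open>No rounding occurs, since the coordinates of a lattice point have integral
    sums.\<close>
  have floor_sum: "real_of_int \<lfloor>\<Sum>l\<in>{Suc 0..k}. z l\<rfloor> = (\<Sum>l\<in>{Suc 0..k}. z l)"
    if "z \<in> lattice_points m" "k \<le> m" for z k
    using that by (intro of_int_floor Ints_sum) (auto simp: lattice_points_def)
  show "(\<lambda>z. \<lambda>k\<in>{0..m}. \<lfloor>\<Sum>l\<in>{Suc 0..k}. z l\<rfloor>)
      \<in> lattice_points m \<inter> dilated_simplex_interior m t \<rightarrow> rulers m t"
  proof
    fix z assume z: "z \<in> lattice_points m \<inter> dilated_simplex_interior m t"
    have "\<lfloor>\<Sum>l\<in>{Suc 0..k}. z l\<rfloor> < \<lfloor>\<Sum>l\<in>{Suc 0..Suc k}. z l\<rfloor>" if "k < m" for k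
    proof -
      have "0 < z (Suc k)"
        using z that by (simp add: dilated_simplex_interior_def)
      then have "real_of_int \<lfloor>\<Sum>l\<in>{Suc 0..k}. z l\<rfloor> < real_of_int \<lfloor>\<Sum>l\<in>{Suc 0..Suc k}. z l\<rfloor>"
        using z that by (subst (1 2) floor_sum) auto
      then show ?thesis
        by (simp only: of_int_less_iff)
    qed
    moreover have "\<lfloor>\<Sum>l\<in>{Suc 0..m}. z l\<rfloor> = int t"
      using z by (simp add: dilated_simplex_interior_def)
    ultimately show "(\<lambda>k\<in>{0..m}. \<lfloor>\<Sum>l\<in>{Suc 0..k}. z l\<rfloor>) \<in> rulers m t"
      by (simp add: rulers_def)
  qed
  show "successive_differences m (\<lambda>k\<in>{0..m}. \<lfloor>\<Sum>l\<in>{Suc 0..k}. z l\<rfloor>) = z"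
    if z: "z \<in> lattice_points m \<inter> dilated_simplex_interior m t" for z
  proof (rule extensionalityI[of _ "{1..m}"])
    show "z \<in> extensional {1..m}"
      using z by (auto simp: lattice_points_def real_space_def PiE_def)
    fix i assume i: "i \<in> {1..m}"
    then obtain k where "i = Suc k"
      by (cases i) auto
    then have "successive_differences m (\<lambda>k\<in>{0..m}. \<lfloor>\<Sum>l\<in>{Suc 0..k}. z l\<rfloor>) i
        = real_of_int \<lfloor>\<Sum>l\<in>{Suc 0..Suc k}. z l\<rfloor> - real_of_int \<lfloor>\<Sum>l\<in>{Suc 0..k}. z l\<rfloor>"
      \<comment> \<open>The sum up to \<open>Suc k\<close> is kept folded so that
        \<open>floor_sum\<close> can rewrite both floors.\<close>
      using i by (simp add: successive_differences_def del: sum.cl_ivl_Suc)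
    also have "\<dots> = z i"
      using z i \<open>i = Suc k\<close> by (subst (1 2) floor_sum) auto
    finally show "successive_differences m (\<lambda>k\<in>{0..m}. \<lfloor>\<Sum>l\<in>{Suc 0..k}. z l\<rfloor>) i = z i" .
  qed (simp add: successive_differences_def)
  show "(\<lambda>k\<in>{0..m}. \<lfloor>\<Sum>l\<in>{Suc 0..k}. successive_differences m x l\<rfloor>) = x"
    if x: "x \<in> rulers m t" for x
  proof (rule extensionalityI[of _ "{0..m}"])
    show "x \<in> extensional {0..m}"
      using x by (auto simp: rulers_def PiE_def)
    fix k assume "k \<in> {0..m}"
    then show "(\<lambda>k\<in>{0..m}. \<lfloor>\<Sum>l\<in>{Suc 0..k}. successive_differences m x l\<rfloor>) k = x k"
      using x by (simp add: sum_successive_differences rulers_def)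
  qed simp
qed

lemma card_representations_gt_if_forbidden:
  assumes x: "x \<in> rulers m t"
    and S: "S \<in> forbidden_subspaces m g" "successive_differences m x \<in> S"
  obtains n where "n > 0" "g < card (representations m x n)"
proof -
  from S(1) obtain U where U: "S = equal_sums_subspace m g U"
    and cons: "\<forall>a\<le>g. consecutive_subset m (U a)"
    and antichain: "\<forall>a\<le>g. \<forall>b\<le>g. a \<noteq> b \<longrightarrow> \<not> U a \<subseteq> U b"
    unfolding forbidden_subspaces_def mem_Collect_eq by (elim exE conjE)
  have sums: "sum (successive_differences m x) (U a) = sum (successive_differences m x) (U b)"
    if "a \<le> g" "b \<le> g" for a b
    using S(2) that unfolding U equal_sums_subspace_def by blast
  have "\<exists>i j. i < j \<and> j \<le> m \<and> U a = {Suc i..j}" if a: "a \<le> g" for a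
  proof -
    obtain j k where "1 \<le> j" "j \<le> k" "k \<le> m" "U a = {j..k}"
      using cons a unfolding consecutive_subset_def by metis
    then show ?thesis
      \<comment> \<open>As \<open>1 \<le> j\<close>, the subtraction does not truncate, and
        \<open>{j..k}\<close> is the block between markings \<open>j - 1\<close> and
        \<open>k\<close>.\<close>
      by (intro exI[of _ "j - 1"] exI[of _ k]) auto
  qed
  then obtain I J where IJ: "\<And>a. a \<le> g \<Longrightarrow> I a < J a \<and> J a \<le> m \<and> U a = {Suc (I a)..J a}"
    by metis
  define n where "n = x (J 0) - x (I 0)"
  have diff: "x (J a) - x (I a) = n" if a: "a \<le> g" for a
  proof -
    have "real_of_int (x (J a) - x (I a)) = real_of_int (x (J 0) - x (I 0))"
      using sums[OF a le0] IJ[OF a] IJ[OF le0]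
        sum_successive_differences[of "I a" "J a" m x]
        sum_successive_differences[of "I 0" "J 0" m x] by simp
    then show ?thesis
      unfolding n_def by linarith
  qed
  have "n > 0"
    using ruler_less[OF x, of "I 0" "J 0"] IJ[of 0] by (simp add: n_def)
  \<comment> \<open>Equal pairs of endpoints give equal sets, which the antichain condition excludes
    for different indices.\<close>
  moreover have "inj_on (\<lambda>a. (I a, J a)) {..g}"
  proof (rule inj_onI)
    fix a b assume "a \<in> {..g}" "b \<in> {..g}" "(I a, J a) = (I b, J b)"
    then show "a = b"
      using antichain IJ[of a] IJ[of b] by (metis Pair_inject atMost_iff order_refl)
  qed
  \<comment> \<open>The index set \<open>{..g}\<close> has \<open>g + 1\<close> elements, whence the
    strict inequality.\<close>
  then have "card {..g} \<le> card (representations m x n)"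
    by (rule card_inj_on_le[OF _ _ finite_representations])
      (use IJ diff in \<open>auto simp: representations_def\<close>)
  ultimately show ?thesis
    by (intro that[of n]) auto
qed

lemma forbidden_if_card_representations_gt:
  assumes x: "x \<in> rulers m t" and card: "g < card (representations m x n)"
  obtains S where "S \<in> forbidden_subspaces m g" "successive_differences m x \<in> S"
proof -
  \<comment> \<open>There may be more than \<open>g + 1\<close> representations; exactly that many
    are selected and numbered from 0 to \<open>g\<close>.\<close>
  obtain R where R: "R \<subseteq> representations m x n" "card R = Suc g" "finite R"
    using card by (metis Suc_leI obtain_subset_with_card_n)
  then obtain f where f: "bij_betw f {0..<Suc g} R"
    by (metis ex_bij_betw_nat_finite)
  define I J where "I a = fst (f a)" and "J a = snd (f a)" for a
  define U where "U a = {Suc (I a)..J a}" for a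
  have rep: "I a < J a \<and> J a \<le> m \<and> x (J a) - x (I a) = n" if "a \<le> g" for a
  proof -
    have "f a \<in> R"
      using f that by (auto simp: bij_betw_def)
    then show ?thesis
      using R(1) by (auto simp: representations_def I_def J_def)
  qed
  have "consecutive_subset m (U a)" if "a \<le> g" for a
    unfolding consecutive_subset_def U_def
    by (rule exI[of _ "Suc (I a)"], rule exI[of _ "J a"]) (use rep[OF that] in auto)
  moreover have "\<not> U a \<subseteq> U b" if ab: "a \<le> g" "b \<le> g" "a \<noteq> b" for a b
  proof
    assume "U a \<subseteq> U b"
    \<comment> \<open>Inclusion bounds the endpoints because \<open>U a\<close> is nonempty.\<close>
    then have le: "I b \<le> I a" "J a \<le> J b"
      using rep[OF ab(1)] by (auto simp: U_def)
    have "x (I b) \<le> x (I a)" "x (J a) \<le> x (J b)"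
      using le rep[OF ab(1)] rep[OF ab(2)] by (auto intro: ruler_le[OF x])
    \<comment> \<open>The interval from \<open>x (I a)\<close> to \<open>x (J a)\<close> lies inside
      the one from \<open>x (I b)\<close> to \<open>x (J b)\<close>, and both have length
      \<open>n\<close>, so they coincide. Strict monotonicity then identifies the indices, against
      the injectivity of \<open>f\<close>.\<close>
    then have "x (I b) = x (I a)" "x (J a) = x (J b)"
      using rep[OF ab(1)] rep[OF ab(2)] by auto
    then have "I b = I a" "J a = J b"
      using le ruler_less[OF x, of "I b" "I a"] ruler_less[OF x, of "J a" "J b"]
        rep[OF ab(1)] rep[OF ab(2)] by (auto simp: le_less)
    then have "f a = f b"
      by (simp add: I_def J_def prod_eq_iff)
    then show False
      using f ab by (auto simp: bij_betw_def inj_on_def)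
  qed
  ultimately have "equal_sums_subspace m g U \<in> forbidden_subspaces m g"
    unfolding forbidden_subspaces_def by blast
  moreover have "sum (successive_differences m x) (U a) = real_of_int n" if "a \<le> g" for a
    using rep[OF that] sum_successive_differences[of "I a" "J a" m x] by (simp add: U_def)
  then have "successive_differences m x \<in> equal_sums_subspace m g U"
    by (auto simp: equal_sums_subspace_def real_space_def successive_differences_def)
  ultimately show ?thesis
    by (rule that)
qed

theorem proposition3p8:
  fixes m g t :: nat
  assumes "m \<ge> 1" and "g \<ge> 1" and "t \<ge> 1"
  shows "bij_betw (successive_differences m) (B2_minus_sets g m t)
    {z \<in> lattice_points m \<inter> dilated_simplex_interior m t.
       \<forall>S \<in> forbidden_subspaces m g. z \<notin> S}"
proof -
  have "(\<forall>n>0. card (representations m x n) \<le> g) \<longleftrightarrow>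
      (\<forall>S \<in> forbidden_subspaces m g. successive_differences m x \<notin> S)" if x: "x \<in> rulers m t" for x
  proof
    assume "\<forall>n>0. card (representations m x n) \<le> g"
    then show "\<forall>S \<in> forbidden_subspaces m g. successive_differences m x \<notin> S"
      using card_representations_gt_if_forbidden[OF x] by (metis not_le)
  next
    assume no_S: "\<forall>S \<in> forbidden_subspaces m g. successive_differences m x \<notin> S"
    have "card (representations m x n) \<le> g" for n
    proof (rule ccontr)
      assume "\<not> card (representations m x n) \<le> g"
      then have "g < card (representations m x n)"
        by simp
      then obtain S where "S \<in> forbidden_subspaces m g" "successive_differences m x \<in> S"
        by (rule forbidden_if_card_representations_gt[OF x])
      with no_S show False
        by blast
    qed
    then show "\<forall>n>0. card (representations m x n) \<le> g"
      by blast
  qed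
  then show ?thesis
    \<comment> \<open>The bijection on all rulers restricts to the two subsets, since their defining
      conditions correspond under it.\<close>
    unfolding B2_minus_sets_def by (intro bij_betw_Collect bij_betw_rulers_lattice_points) auto
qed

end
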